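(* Let $S$ be a densely defined, closed, symmetric operator in a Hilbert space $\mathcal{H}$ and let $\{\mathcal{G},\Gamma_0,\Gamma_1\}$ be a quasi boundary triple for $T\subset S^*$ with $A_0=T\upharpoonright\ker\Gamma_0$, $\gamma$-field $\gamma$ and Weyl function $M$. Let $\lambda_0\in\rho(A_0)\cap\mathbb{R}$ and let $B$ be a symmetric operator in $\mathcal{G}$. Assume that $B\subset B_1B_2$ holds with some operators $B_1,B_2$ in $\mathcal{G}$ and that the following conditions are satisfied: (i) $1\in\rho\bigl(B_2\overline{M(\lambda_0)B_1}\bigr)$; (ii) $\operatorname{ran}\bigl(B_2\overline{M(\lambda_0)B_1}\bigr)\subset\operatorname{ran}\Gamma_0\cap\operatorname{dom}B_1$; (iii) $\operatorname{ran}(B_1\upharpoonright\operatorname{ran}\Gamma_0)\subset\operatorname{ran}\Gamma_0$; (iv) $\operatorname{ran}(B_2\upharpoonright\operatorname{ran}\Gamma_1)\subset\operatorname{ran}\Gamma_0$; (v) $\operatorname{ran}\Gamma_1\subset\operatorname{dom}B$. Then the operator $$A_{[B]}f=Tf,\qquad \operatorname{dom}A_{[B]}=\{f\in\operatorname{dom}T:\Gamma_0f=B\Gamma_1f\},$$ is self-adjoint in $\mathcal{H}$, and for every $\lambda\in\rho(A_0)\cap\rho(A_{[B]})$ the resolvent formula $$(A_{[B]}-\lambda)^{-1}-(A_0-\lambda)^{-1}=\gamma(\lambda)B_1\bigl(1-B_2M(\lambda)B_1\bigr)^{-1}B_2\gamma(\overline{\lambda})^*$$ is valid.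
   Context: Hilbert spaces are complex; "operator in $\mathcal{G}$" means a linear, possibly unbounded operator defined on a linear subspace of $\mathcal{G}$. Products of operators have their natural (maximal) domains, and $B\subset B_1B_2$ means that $B_1B_2$ extends $B$. For an operator $C$ and a subspace $\mathcal{D}$, $\operatorname{ran}(C\upharpoonright\mathcal{D})=\{C\varphi:\varphi\in\operatorname{dom}C\cap\mathcal{D}\}$. $\rho(\cdot)$ denotes the resolvent set, and $\overline{C}$ denotes the closure of the operator $C$ (writing $\overline{M(\lambda_0)B_1}$ presupposes that $M(\lambda_0)B_1$ is closable). Quasi boundary triple: Let $S$ be a densely defined, closed, symmetric operator in $\mathcal{H}$ and let $T$ be a closable operator with $\overline{T}=S^*$. A triple $\{\mathcal{G},\Gamma_0,\Gamma_1\}$ is a quasi boundary triple for $T\subset S^*$ if $(\mathcal{G},(\cdot,\cdot)_{\mathcal{G}})$ is a Hilbert space and $\Gamma_0,\Gamma_1:\operatorname{dom}T\to\mathcal{G}$ are linear mappings such that (a) $(Tf,g)_{\mathcal{H}}-(f,Tg)_{\mathcal{H}}=(\Gamma_1f,\Gamma_0g)_{\mathcal{G}}-(\Gamma_0f,\Gamma_1g)_{\mathcal{G}}$ for all $f,g\in\operatorname{dom}T$; (b) the range of $(\Gamma_0,\Gamma_1)^\top:\operatorname{dom}T\to\mathcal{G}\times\mathcal{G}$ is dense; (c) $A_0:=T\upharpoonright\ker\Gamma_0$ is self-adjoint in $\mathcal{H}$. $\gamma$-field and Weyl function: For $\lambda\in\rho(A_0)$ one has the direct sum decomposition $\operatorname{dom}T=\ker\Gamma_0\,\dot+\,\ker(T-\lambda)$,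 so $\Gamma_0\upharpoonright\ker(T-\lambda)$ is injective with range $\operatorname{ran}\Gamma_0$. Define $\gamma(\lambda):=(\Gamma_0\upharpoonright\ker(T-\lambda))^{-1}$ and $M(\lambda):=\Gamma_1\gamma(\lambda)$; both have domain $\operatorname{ran}\Gamma_0$. Each $\gamma(\lambda)$ is a densely defined bounded operator from $\mathcal{G}$ to $\mathcal{H}$, and $\gamma(\overline\lambda)^*=\Gamma_1(A_0-\lambda)^{-1}$ is bounded and everywhere defined from $\mathcal{H}$ to $\mathcal{G}$. *)

theory Defs
  imports "HOL-Analysis.Analysis"
begin

section \<open>Complex Hilbert spaces\<close>

text \<open>The inner product is linear in the first and antilinear in the second argument.\<close>

class chilbert_space = banach +
  fixes scaleC :: "complex \<Rightarrow> 'a \<Rightarrow> 'a" (infixr "*\<^sub>C" 75)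
    and cinner :: "'a \<Rightarrow> 'a \<Rightarrow> complex"
  assumes scaleC_add_right: "a *\<^sub>C (x + y) = a *\<^sub>C x + a *\<^sub>C y"
    and scaleC_add_left: "(a + b) *\<^sub>C x = a *\<^sub>C x + b *\<^sub>C x"
    and scaleC_scaleC: "a *\<^sub>C b *\<^sub>C x = (a * b) *\<^sub>C x"
    and scaleR_scaleC: "r *\<^sub>R x = complex_of_real r *\<^sub>C x"
    and cinner_commute: "cinner x y = cnj (cinner y x)"
    and cinner_add_left: "cinner (x + y) z = cinner x z + cinner y z"
    and cinner_scaleC_left: "cinner (a *\<^sub>C x) y = a * cinner x y"
    and cinner_ge_zero: "0 \<le> Re (cinner x x)"
    and norm_eq_sqrt_cinner: "norm x = sqrt (Re (cinner x x))"

instantiation complex :: chilbert_space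
begin

definition scaleC_complex :: "complex \<Rightarrow> complex \<Rightarrow> complex"
  where "scaleC_complex a x = a * x"

definition cinner_complex :: "complex \<Rightarrow> complex \<Rightarrow> complex"
  where "cinner_complex x y = x * cnj y"

instance
proof
  fix x :: complex
  show "norm x = sqrt (Re (cinner x x))"
    by (simp add: cinner_complex_def cmod_def power2_eq_square)
qed (auto simp: scaleC_complex_def cinner_complex_def algebra_simps scaleR_conv_of_real)

end


section \<open>Unbounded operators\<close>

text \<open>
  An operator is represented by its graph, so inclusion of operators is \<open>\<subseteq>\<close>, domain and range are
  \<^const>\<open>Domain\<close> and \<^const>\<open>Range\<close>, the set of all \<open>C x\<close> with \<open>x \<in> dom C \<inter> D\<close> is \<open>C `` D\<close>,
  the (possibly multivalued) inverse is \<open>C\<inverse>\<close>, and the graph of the closure is the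
  topological \<^const>\<open>closure\<close>.
\<close>

type_synonym ('a, 'b) graph = "('a \<times> 'b) set"

definition linear_operator :: "('a::chilbert_space, 'b::chilbert_space) graph \<Rightarrow> bool"
  where "linear_operator C \<longleftrightarrow>
    single_valued C \<and> (0, 0) \<in> C \<and>
    (\<forall>x y x' y'. (x, y) \<in> C \<longrightarrow> (x', y') \<in> C \<longrightarrow> (x + x', y + y') \<in> C) \<and>
    (\<forall>a x y. (x, y) \<in> C \<longrightarrow> (a *\<^sub>C x, a *\<^sub>C y) \<in> C)"

text \<open>Meaningful only for single-valued \<open>C\<close> and \<open>x \<in> Domain C\<close>.\<close>

definition op_app :: "('a, 'b) graph \<Rightarrow> 'a \<Rightarrow> 'b" (infixl "\<cdot>" 90)
  where "C \<cdot> x = (THE y. (x, y) \<in> C)"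

text \<open>\<open>C \<odot> D\<close> is the product in operator order: \<open>D\<close> acts first.\<close>

definition op_prod :: "('b, 'c) graph \<Rightarrow> ('a, 'b) graph \<Rightarrow> ('a, 'c) graph" (infixr "\<odot>" 80)
  where "C \<odot> D = D O C"

definition op_diff :: "('a, 'b::ab_group_add) graph \<Rightarrow> ('a, 'b) graph \<Rightarrow> ('a, 'b) graph"
    (infixl "\<ominus>" 65)
  where "C \<ominus> D = {(x, y - z) | x y z. (x, y) \<in> C \<and> (x, z) \<in> D}"

definition scalar_op :: "complex \<Rightarrow> ('a::chilbert_space, 'a) graph"
  where "scalar_op a = {(x, a *\<^sub>C x) | x. True}"

definition op_restrict :: "('a, 'b) graph \<Rightarrow> 'a set \<Rightarrow> ('a, 'b) graph" (infixl "\<restriction>" 85)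
  where "C \<restriction> D = {(x, y) \<in> C. x \<in> D}"

definition op_ker :: "('a, 'b::zero) graph \<Rightarrow> 'a set"
  where "op_ker C = {x. (x, 0) \<in> C}"

definition densely_defined :: "('a::chilbert_space, 'b) graph \<Rightarrow> bool"
  where "densely_defined C \<longleftrightarrow> closure (Domain C) = UNIV"

definition closable :: "('a::chilbert_space, 'b::chilbert_space) graph \<Rightarrow> bool"
  where "closable C \<longleftrightarrow> single_valued (closure C)"

text \<open>The adjoint is an operator precisely when \<open>C\<close> is densely defined.\<close>

definition adjoint_op :: "('a::chilbert_space, 'b::chilbert_space) graph \<Rightarrow> ('b, 'a) graph"
  where "adjoint_op C = {(u, v). \<forall>(x, y) \<in> C. cinner y u = cinner x v}"

definition symmetric_op :: "('a::chilbert_space, 'a) graph \<Rightarrow> bool"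
  where "symmetric_op C \<longleftrightarrow>
    (\<forall>x \<in> Domain C. \<forall>y \<in> Domain C. cinner (C \<cdot> x) y = cinner x (C \<cdot> y))"

definition self_adjoint_op :: "('a::chilbert_space, 'a) graph \<Rightarrow> bool"
  where "self_adjoint_op C \<longleftrightarrow>
    linear_operator C \<and> densely_defined C \<and> adjoint_op C = C"

definition bounded_everywhere_defined ::
    "('a::chilbert_space, 'b::chilbert_space) graph \<Rightarrow> bool"
  where "bounded_everywhere_defined C \<longleftrightarrow>
    linear_operator C \<and> Domain C = UNIV \<and> (\<exists>K. \<forall>x. norm (C \<cdot> x) \<le> K * norm x)"

definition resolvent_set :: "('a::chilbert_space, 'a) graph \<Rightarrow> complex set"
  where "resolvent_set C = {z. bounded_everywhere_defined ((C \<ominus> scalar_op z)\<inverse>)}"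


section \<open>Quasi boundary triples\<close>

definition quasi_boundary_triple ::
    "('h::chilbert_space, 'h) graph \<Rightarrow> ('h, 'h) graph \<Rightarrow>
     ('h, 'g::chilbert_space) graph \<Rightarrow> ('h, 'g) graph \<Rightarrow> bool"
  where "quasi_boundary_triple S T \<Gamma>\<^sub>0 \<Gamma>\<^sub>1 \<longleftrightarrow>
    linear_operator T \<and> closable T \<and> closure T = adjoint_op S \<and>
    linear_operator \<Gamma>\<^sub>0 \<and> Domain \<Gamma>\<^sub>0 = Domain T \<and>
    linear_operator \<Gamma>\<^sub>1 \<and> Domain \<Gamma>\<^sub>1 = Domain T \<and>
    (\<forall>f \<in> Domain T. \<forall>g \<in> Domain T.
       cinner (T \<cdot> f) g - cinner f (T \<cdot> g) =
       cinner (\<Gamma>\<^sub>1 \<cdot> f) (\<Gamma>\<^sub>0 \<cdot> g) - cinner (\<Gamma>\<^sub>0 \<cdot> f) (\<Gamma>\<^sub>1 \<cdot> g)) \<and>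
    closure {(\<Gamma>\<^sub>0 \<cdot> f, \<Gamma>\<^sub>1 \<cdot> f) | f. f \<in> Domain T} = UNIV \<and>
    self_adjoint_op (T \<restriction> op_ker \<Gamma>\<^sub>0)"

definition gamma_field ::
    "('h::chilbert_space, 'h) graph \<Rightarrow> ('h, 'g::chilbert_space) graph \<Rightarrow> complex \<Rightarrow> ('g, 'h) graph"
  where "gamma_field T \<Gamma>\<^sub>0 z = (\<Gamma>\<^sub>0 \<restriction> op_ker (T \<ominus> scalar_op z))\<inverse>"

definition weyl_function ::
    "('h::chilbert_space, 'h) graph \<Rightarrow> ('h, 'g::chilbert_space) graph \<Rightarrow> ('h, 'g) graph \<Rightarrow>
     complex \<Rightarrow> ('g, 'g) graph"
  where "weyl_function T \<Gamma>\<^sub>0 \<Gamma>\<^sub>1 z = \<Gamma>\<^sub>1 \<odot> gamma_field T \<Gamma>\<^sub>0 z"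

definition ext_operator ::
    "('h::chilbert_space, 'h) graph \<Rightarrow> ('h, 'g::chilbert_space) graph \<Rightarrow> ('h, 'g) graph \<Rightarrow>
     ('g, 'g) graph \<Rightarrow> ('h, 'h) graph"
  where "ext_operator T \<Gamma>\<^sub>0 \<Gamma>\<^sub>1 B =
    T \<restriction> {f \<in> Domain T. \<Gamma>\<^sub>1 \<cdot> f \<in> Domain B \<and> \<Gamma>\<^sub>0 \<cdot> f = B \<cdot> (\<Gamma>\<^sub>1 \<cdot> f)}"

end

(*
A symmetric operator A such that A - r is onto for some real r is self-adjoint, so for A_[B] it is
enough to solve (A_[B] - lambda_0) f = h. With f = f_0 + gamma(lambda_0) B_1 psi and
f_0 = (A_0 - lambda_0)^{-1} h, the boundary condition becomes
psi - B_2 M(lambda_0) B_1 psi = B_2 Gamma_1 f_0, which (i) solves with the closure of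
M(lambda_0) B_1; by (ii)-(iv) the solution psi lies in the domain of M(lambda_0) B_1 itself.
The resolvent formula comes from reading the same computation backwards: for f in dom A_[B] with
(A_[B] - lambda) f = h, the vector psi = B_2 Gamma_1 f satisfies
(1 - B_2 M(lambda) B_1) psi = B_2 gamma(cnj lambda)^* h and f - f_0 = gamma(lambda) B_1 psi.
*)
theory Submission
  imports Defs
begin

section \<open>Geometry of complex Hilbert spaces\<close>

lemma scaleC_zero_right [simp]: "a *\<^sub>C (0::'a::chilbert_space) = 0"
  using scaleC_add_right[of a 0 "0::'a"] by simp

lemma scaleC_zero_left [simp]: "0 *\<^sub>C (x::'a::chilbert_space) = 0"
  using scaleC_add_left[of 0 0 x] by simp

lemma scaleC_one [simp]: "1 *\<^sub>C (x::'a::chilbert_space) = x"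
  using scaleR_scaleC[of 1 x] by simp

lemma scaleC_minus_one [simp]: "(- 1) *\<^sub>C (x::'a::chilbert_space) = - x"
  using scaleR_scaleC[of "- 1" x] by simp

lemma scaleC_minus_right: "a *\<^sub>C (- x) = - (a *\<^sub>C (x::'a::chilbert_space))"
  using scaleC_add_right[of a "- x" x] by (simp add: eq_neg_iff_add_eq_0)

lemma scaleC_diff_right: "a *\<^sub>C (x - y) = a *\<^sub>C x - a *\<^sub>C (y::'a::chilbert_space)"
  using scaleC_add_right[of a x "- y"] by (simp add: scaleC_minus_right)

lemma cinner_add_right: "cinner x (y + z) = cinner x y + cinner x (z::'a::chilbert_space)"
  by (metis cinner_add_left cinner_commute complex_cnj_add)

lemma cinner_scaleC_right: "cinner x (a *\<^sub>C y) = cnj a * cinner x (y::'a::chilbert_space)"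
  by (metis cinner_commute cinner_scaleC_left complex_cnj_mult)

lemma cinner_zero_left [simp]: "cinner 0 (x::'a::chilbert_space) = 0"
  using cinner_scaleC_left[of 0 x x] by simp

lemma cinner_zero_right [simp]: "cinner (x::'a::chilbert_space) 0 = 0"
  using cinner_scaleC_right[of x 0 x] by simp

lemma cinner_minus_left: "cinner (- x) y = - cinner x (y::'a::chilbert_space)"
  using cinner_scaleC_left[of "- 1" x y] by simp

lemma cinner_minus_right: "cinner x (- y) = - cinner x (y::'a::chilbert_space)"
  using cinner_scaleC_right[of x "- 1" y] by simp

lemma cinner_diff_left: "cinner (x - y) z = cinner x z - cinner y (z::'a::chilbert_space)"
  using cinner_add_left[of x "- y" z] by (simp add: cinner_minus_left)

lemma cinner_diff_right: "cinner x (y - z) = cinner x y - cinner x (z::'a::chilbert_space)"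
  using cinner_add_right[of x y "- z"] by (simp add: cinner_minus_right)

lemmas cinner_algebra = cinner_add_left cinner_add_right cinner_diff_left cinner_diff_right
  cinner_scaleC_left cinner_scaleC_right cinner_minus_left cinner_minus_right

lemma Re_cinner_self: "Re (cinner x x) = (norm (x::'a::chilbert_space))\<^sup>2"
  by (simp add: norm_eq_sqrt_cinner cinner_ge_zero)

lemma cinner_self_eq_0: "cinner x x = 0 \<Longrightarrow> (x::'a::chilbert_space) = 0"
  using Re_cinner_self[of x] by simp

lemma Re_cinner_commute: "Re (cinner y x) = Re (cinner x (y::'a::chilbert_space))"
  by (metis cinner_commute cnj.simps(1))

lemma norm_add_sq:
  "(norm (x + y))\<^sup>2 = (norm x)\<^sup>2 + (norm y)\<^sup>2 + 2 * Re (cinner x (y::'a::chilbert_space))"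
  using Re_cinner_commute[of x y] by (simp add: Re_cinner_self[symmetric] cinner_algebra)

lemma norm_diff_sq:
  "(norm (x - y))\<^sup>2 = (norm x)\<^sup>2 + (norm y)\<^sup>2 - 2 * Re (cinner x (y::'a::chilbert_space))"
  using Re_cinner_commute[of x y] by (simp add: Re_cinner_self[symmetric] cinner_algebra)

lemma norm_scaleC: "norm (a *\<^sub>C (x::'a::chilbert_space)) = cmod a * norm x"
proof -
  have "(norm (a *\<^sub>C x))\<^sup>2 = Re ((a * cnj a) * cinner x x)"
    unfolding Re_cinner_self[symmetric] cinner_algebra by (simp only: mult_ac)
  also have "\<dots> = (cmod a * norm x)\<^sup>2"
    unfolding complex_norm_square[symmetric] Re_complex_of_real of_real_power[symmetric]
    by (simp add: Re_cinner_self power_mult_distrib)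
  finally show ?thesis by (simp add: power2_eq_iff_nonneg)
qed

lemma parallelogram_law:
  "(norm (x + y))\<^sup>2 + (norm (x - y))\<^sup>2 = 2 * (norm x)\<^sup>2 + 2 * (norm (y::'a::chilbert_space))\<^sup>2"
  by (simp add: norm_add_sq norm_diff_sq)

text \<open>Polarization gives continuity of the inner product without the Cauchy--Schwarz inequality.\<close>

lemma tendsto_cinner_right:
  fixes x :: "'a::chilbert_space"
  assumes "u \<longlonglongrightarrow> l"
  shows "(\<lambda>n. cinner x (u n)) \<longlonglongrightarrow> cinner x l"
proof -
  have re: "Re (cinner y w) = ((norm (y + w))\<^sup>2 - (norm (y - w))\<^sup>2) / 4" for y w :: 'a
    by (simp add: norm_add_sq norm_diff_sq)
  have im: "Im (cinner y w) = Re (cinner ((- \<i>) *\<^sub>C y) w)" for y w :: 'a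
    by (simp add: cinner_scaleC_left)
  have "(\<lambda>n. Re (cinner y (u n))) \<longlonglongrightarrow> Re (cinner y l)" for y
    unfolding re by (intro tendsto_intros assms) simp
  then show ?thesis
    unfolding tendsto_complex_iff im by blast
qed

text \<open>Approximate \<open>v\<close> itself by elements of \<open>D\<close>: continuity of the
  inner product turns the orthogonality into \<open>cinner v v = 0\<close>.\<close>

lemma dense_orthogonal_zero:
  fixes v :: "'a::chilbert_space"
  assumes "closure D = UNIV" and orth: "\<And>x. x \<in> D \<Longrightarrow> cinner x v = 0"
  shows "v = 0"
proof -
  have "v \<in> closure D" using assms by simp
  then obtain u where u: "\<And>n. u n \<in> D" "u \<longlonglongrightarrow> v"
    unfolding closure_sequential by blast
  have "(\<lambda>n. cinner v (u n)) \<longlonglongrightarrow> cinner v v"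
    using u(2) by (rule tendsto_cinner_right)
  moreover have "cinner v (u n) = 0" for n
    by (metis cinner_commute complex_cnj_zero orth u(1))
  ultimately have "cinner v v = 0"
    by (simp add: LIMSEQ_const_iff)
  then show ?thesis by (rule cinner_self_eq_0)
qed

text \<open>First variation of the squared distance: if \<open>cinner v u\<close> were nonzero, a
  small move of \<open>u\<close> along a suitable complex multiple of \<open>v\<close> would shorten
  it.\<close>

lemma orthogonal_if_closest:
  fixes u v :: "'a::chilbert_space"
  assumes "\<And>a. norm u \<le> norm (u - a *\<^sub>C v)"
  shows "cinner v u = 0"
proof (rule ccontr)
  assume "cinner v u \<noteq> 0"
  define c where "c = cinner u v"
  have c: "cmod c > 0"
    unfolding c_def using \<open>cinner v u \<noteq> 0\<close> cinner_commute[of v u] by simp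
  \<comment> \<open>The summand 1 covers \<open>v = 0\<close> and forces
    \<open>t * (norm v)\<^sup>2 < 1\<close>, so for \<open>a = t * c\<close> the linear gain
    \<open>2 * t * (cmod c)\<^sup>2\<close> exceeds the quadratic loss.\<close>
  define t where "t = 1 / ((norm v)\<^sup>2 + 1)"
  have t: "t > 0" "t * (norm v)\<^sup>2 < 1"
    unfolding t_def by (auto simp: field_simps add_pos_nonneg add_nonneg_pos)
  define a where "a = of_real t * c"
  have "(norm u)\<^sup>2 \<le> (norm (u - a *\<^sub>C v))\<^sup>2"
    using assms by (simp add: power_mono)
  also have "\<dots> = (norm u)\<^sup>2 + (cmod a * norm v)\<^sup>2 - 2 * Re (cnj a * c)"
    unfolding norm_diff_sq norm_scaleC by (simp add: cinner_algebra c_def)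
  also have "cnj a * c = of_real (t * (cmod c)\<^sup>2)"
    unfolding a_def using complex_norm_square[of c] by (simp add: mult.commute mult.left_commute)
  also have "(cmod a * norm v)\<^sup>2 = t * (cmod c)\<^sup>2 * (t * (norm v)\<^sup>2)"
    unfolding a_def using t by (simp add: norm_mult power2_eq_square)
  finally have "2 * (t * (cmod c)\<^sup>2) \<le> t * (cmod c)\<^sup>2 * (t * (norm v)\<^sup>2)"
    by simp
  also have "\<dots> < t * (cmod c)\<^sup>2 * 1"
    using t c by (intro mult_strict_left_mono) auto
  finally show False using t c by simp
qed

text \<open>The projection theorem for the closure of a subspace: a minimizing sequence for the
  distance from \<open>x\<close> to \<open>V\<close> converges to some \<open>p\<close>, and
  \<open>x - p\<close> is orthogonal to \<open>V\<close>, hence zero.\<close>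

lemma dense_if_no_orthogonal:
  fixes V :: "'a::chilbert_space set"
  assumes V: "0 \<in> V" "\<And>x y. x \<in> V \<Longrightarrow> y \<in> V \<Longrightarrow> x + y \<in> V" "\<And>a x. x \<in> V \<Longrightarrow> a *\<^sub>C x \<in> V"
    and orth: "\<And>u. (\<And>x. x \<in> V \<Longrightarrow> cinner x u = 0) \<Longrightarrow> u = 0"
  shows "closure V = UNIV"
proof -
  have "x \<in> closure V" for x
  proof -
    define d where "d = infdist x V"
    have d_le: "d \<le> norm (x - v)" if "v \<in> V" for v
      using infdist_le[OF that, of x] by (simp add: d_def dist_norm)
    have d0: "d \<ge> 0" by (simp add: d_def infdist_nonneg)
    have "\<exists>v\<in>V. norm (x - v) < d + e" if "e > 0" for e
    proof (rule ccontr)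
      assume "\<not> ?thesis"
      then have "d + e \<le> infdist x V"
        using V(1) unfolding infdist_def
        by (auto simp: dist_norm not_less intro!: cINF_greatest)
      then show False using that d_def by simp
    qed
    then have "\<forall>n. \<exists>v\<in>V. norm (x - v) < d + 1 / real (Suc n)" by simp
    then obtain y where y: "\<And>n. y n \<in> V" "\<And>n. norm (x - y n) < d + 1 / real (Suc n)"
      by metis
    have lim: "(\<lambda>n. norm (x - y n)) \<longlonglongrightarrow> d"
    proof (rule real_tendsto_sandwich)
      show "\<forall>\<^sub>F n in sequentially. d \<le> norm (x - y n)" using d_le y(1) by simp
      show "\<forall>\<^sub>F n in sequentially. norm (x - y n) \<le> d + 1 / real (Suc n)"
        using y(2) by (simp add: less_imp_le)
      show "(\<lambda>n. d + 1 / real (Suc n)) \<longlonglongrightarrow> d"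
        using tendsto_add[OF tendsto_const LIMSEQ_inverse_real_of_nat]
        by (simp add: inverse_eq_divide)
    qed simp
    have gap: "(norm (y m - y n))\<^sup>2 \<le> 2 * ((norm (x - y m))\<^sup>2 - d\<^sup>2) + 2 * ((norm (x - y n))\<^sup>2 - d\<^sup>2)"
      for m n
    proof -
      \<comment> \<open>The midpoint is again at distance at least \<open>d\<close> from
        \<open>x\<close>; the parallelogram law then bounds \<open>y m - y n\<close> by the excess
        of the two distances over \<open>d\<close>.\<close>
      have "(1/2) *\<^sub>C (y m + y n) \<in> V" using V y(1) by blast
      then have "d \<le> norm (x - (1/2) *\<^sub>C (y m + y n))" by (rule d_le)
      moreover have "2 *\<^sub>R (x - (1/2) *\<^sub>C (y m + y n)) = (x - y m) + (x - y n)"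
      proof -
        have "2 *\<^sub>R ((1/2) *\<^sub>C (y m + y n)) = y m + y n"
          by (simp add: scaleR_scaleC scaleC_scaleC)
        then show ?thesis by (simp only: scaleR_diff_right) (simp add: scaleR_2)
      qed
      then have "norm ((x - y m) + (x - y n)) = 2 * norm (x - (1/2) *\<^sub>C (y m + y n))"
        by (metis norm_scaleR abs_numeral)
      ultimately have "2 * d \<le> norm ((x - y m) + (x - y n))" by simp
      then have "(2 * d)\<^sup>2 \<le> (norm ((x - y m) + (x - y n)))\<^sup>2"
        using d0 by (intro power_mono) auto
      moreover have "norm ((x - y m) - (x - y n)) = norm (y m - y n)"
        by (simp add: norm_minus_commute)
      ultimately show ?thesis
        using parallelogram_law[of "x - y m" "x - y n"] by (simp add: power_mult_distrib)
    qed
    have "Cauchy y"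
    proof (rule metric_CauchyI)
      fix e :: real assume e: "e > 0"
      have "(\<lambda>n. (norm (x - y n))\<^sup>2 - d\<^sup>2) \<longlonglongrightarrow> d\<^sup>2 - d\<^sup>2"
        by (intro tendsto_intros lim)
      then have "\<forall>\<^sub>F n in sequentially. (norm (x - y n))\<^sup>2 - d\<^sup>2 < e\<^sup>2 / 4"
        using e by (intro order_tendstoD(2)) auto
      then obtain N where N: "\<And>n. n \<ge> N \<Longrightarrow> (norm (x - y n))\<^sup>2 - d\<^sup>2 < e\<^sup>2 / 4"
        unfolding eventually_sequentially by blast
      have "dist (y m) (y n) < e" if "m \<ge> N" "n \<ge> N" for m n
      proof -
        have "(norm (y m - y n))\<^sup>2 < e\<^sup>2"
          using gap[of m n] N[OF that(1)] N[OF that(2)] by simp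
        then show ?thesis using e by (simp add: dist_norm power2_less_imp_less)
      qed
      then show "\<exists>N. \<forall>m\<ge>N. \<forall>n\<ge>N. dist (y m) (y n) < e" by blast
    qed
    then obtain p where p: "y \<longlonglongrightarrow> p"
      using Cauchy_convergent convergent_def by blast
    have "(\<lambda>n. norm (x - y n)) \<longlonglongrightarrow> norm (x - p)"
      by (intro tendsto_intros p)
    then have d: "norm (x - p) = d" using lim LIMSEQ_unique by blast
    have "cinner v (x - p) = 0" if v: "v \<in> V" for v
    proof (rule orthogonal_if_closest)
      fix a
      \<comment> \<open>The limit \<open>p\<close> is only known to lie in the closure of
        \<open>V\<close>, so minimality is used for the approximants \<open>y n\<close> and carried
        to the limit.\<close>
      have "(\<lambda>n. norm (x - (y n + a *\<^sub>C v))) \<longlonglongrightarrow> norm (x - (p + a *\<^sub>C v))"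
        by (intro tendsto_intros p)
      moreover have "d \<le> norm (x - (y n + a *\<^sub>C v))" for n
        using d_le V y(1) v by blast
      ultimately have "d \<le> norm (x - (p + a *\<^sub>C v))"
        by (meson LIMSEQ_le_const)
      then show "norm (x - p) \<le> norm (x - p - a *\<^sub>C v)" by (simp add: d algebra_simps)
    qed
    then have "x - p = 0" by (rule orth)
    then show "x \<in> closure V"
      using p y(1) by (auto simp: closure_sequential)
  qed
  then show ?thesis by blast
qed

section \<open>Linear operators\<close>

lemma
  assumes "linear_operator C"
  shows linear_operator_unique: "\<lbrakk>(x, y) \<in> C; (x, y') \<in> C\<rbrakk> \<Longrightarrow> y = y'"
    and linear_operator_zero: "(0, 0) \<in> C"
    and linear_operator_add: "\<lbrakk>(x, y) \<in> C; (x', y') \<in> C\<rbrakk> \<Longrightarrow> (x + x', y + y') \<in> C"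
    and linear_operator_scaleC: "(x, y) \<in> C \<Longrightarrow> (a *\<^sub>C x, a *\<^sub>C y) \<in> C"
  using assms unfolding linear_operator_def single_valued_def by blast+

lemma linear_operator_diff:
  assumes C: "linear_operator C" and "(x, y) \<in> C" "(x', y') \<in> C"
  shows "(x - x', y - y') \<in> C"
  using linear_operator_add[OF C assms(2) linear_operator_scaleC[OF C assms(3), of "- 1"]] by simp

lemma op_app_eq: "\<lbrakk>linear_operator C; (x, y) \<in> C\<rbrakk> \<Longrightarrow> C \<cdot> x = y"
  unfolding op_app_def by (blast intro: linear_operator_unique)

lemma op_app_mem: "\<lbrakk>linear_operator C; x \<in> Domain C\<rbrakk> \<Longrightarrow> (x, C \<cdot> x) \<in> C"
  using op_app_eq by blast

text \<open>This fixes the form in which the equation \<open>(C - z) f = h\<close> is written from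
  here on: the pair of \<open>f\<close> and \<open>h + z f\<close> lies in the graph of
  \<open>C\<close>.\<close>

lemma mem_op_diff_scalar: "(x, y) \<in> C \<ominus> scalar_op z \<longleftrightarrow> (x, y + z *\<^sub>C x) \<in> C"
  unfolding op_diff_def scalar_op_def by force

lemma resolvent_onto:
  assumes "z \<in> resolvent_set C"
  obtains f where "(f, h + z *\<^sub>C f) \<in> C"
proof -
  have "h \<in> Domain ((C \<ominus> scalar_op z)\<inverse>)"
    using assms unfolding resolvent_set_def bounded_everywhere_defined_def by simp
  then show thesis using that by (auto simp: mem_op_diff_scalar)
qed

lemma resolvent_unique:
  assumes "z \<in> resolvent_set C" "(f, h + z *\<^sub>C f) \<in> C" "(g, h + z *\<^sub>C g) \<in> C"
  shows "f = g"
  using assms linear_operator_unique[of "(C \<ominus> scalar_op z)\<inverse>" h f g]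
  unfolding resolvent_set_def bounded_everywhere_defined_def by (simp add: mem_op_diff_scalar)

lemma resolvent_bound:
  assumes "z \<in> resolvent_set C"
  obtains K where "\<And>f h. (f, h + z *\<^sub>C f) \<in> C \<Longrightarrow> norm f \<le> K * norm h"
proof -
  let ?R = "(C \<ominus> scalar_op z)\<inverse>"
  obtain K where K: "\<And>h. norm (?R \<cdot> h) \<le> K * norm h" and R: "linear_operator ?R"
    using assms unfolding resolvent_set_def bounded_everywhere_defined_def by blast
  have "norm f \<le> K * norm h" if "(f, h + z *\<^sub>C f) \<in> C" for f h
    using K[of h] op_app_eq[OF R, of h f] that by (simp add: mem_op_diff_scalar)
  then show thesis using that by blast
qed

section \<open>Self-adjointness criterion and resolvents of self-adjoint operators\<close>

lemma self_adjoint_op_cinner: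
  assumes "self_adjoint_op A" "(x, y) \<in> A" "(u, v) \<in> A"
  shows "cinner y u = cinner x v"
proof -
  have "(u, v) \<in> adjoint_op A" using assms unfolding self_adjoint_op_def by simp
  then show ?thesis using assms(2) unfolding adjoint_op_def by blast
qed

text \<open>For a pair \<open>(u, v)\<close> in the adjoint relation, solve
  \<open>(A - r) f = v - r u\<close>. Then \<open>u - f\<close> is orthogonal to the range of
  \<open>A - r\<close>, which is the whole space, so \<open>u = f\<close>. Density of the domain is
  part of the conclusion and follows from the same argument.\<close>

lemma self_adjoint_opI:
  fixes A :: "('a::chilbert_space, 'a) graph" and r :: real
  assumes A: "linear_operator A"
    and sym: "\<And>x y u v. (x, y) \<in> A \<Longrightarrow> (u, v) \<in> A \<Longrightarrow> cinner y u = cinner x v"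
    and onto: "\<And>h. \<exists>f. (f, h + of_real r *\<^sub>C f) \<in> A"
  shows "self_adjoint_op A"
proof -
  have *: "(u, v) \<in> A" if uv: "\<And>x y. (x, y) \<in> A \<Longrightarrow> cinner y u = cinner x v" for u v
  proof -
    obtain f where f: "(f, v - of_real r *\<^sub>C u + of_real r *\<^sub>C f) \<in> A"
      using onto by blast
    \<comment> \<open>With \<open>(A - r) g = u - f\<close> the vector \<open>u - f\<close> can be
      tested against itself; \<open>r\<close> being real makes the two expressions below
      agree.\<close>
    obtain g where g: "(g, (u - f) + of_real r *\<^sub>C g) \<in> A" using onto by blast
    have "cinner (u - f) u = cinner g v - of_real r * cinner g u"
      using uv[OF g] by (simp add: cinner_add_left cinner_scaleC_left eq_diff_eq)
    moreover have "cinner (u - f) f = cinner g v - of_real r * cinner g u"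
      using sym[OF g f] by (simp add: cinner_algebra)
    ultimately have "cinner (u - f) (u - f) = 0" by (simp add: cinner_diff_right)
    then have "u = f" using cinner_self_eq_0 by force
    then show ?thesis using f by simp
  qed
  have "closure (Domain A) = UNIV"
  proof (rule dense_if_no_orthogonal)
    show "0 \<in> Domain A" using linear_operator_zero[OF A] by blast
    show "x + y \<in> Domain A" if "x \<in> Domain A" "y \<in> Domain A" for x y
      using that linear_operator_add[OF A] by blast
    show "a *\<^sub>C x \<in> Domain A" if "x \<in> Domain A" for a x
      using that linear_operator_scaleC[OF A] by blast
    fix u assume u: "\<And>x. x \<in> Domain A \<Longrightarrow> cinner x u = 0"
    obtain f where f: "(f, u + of_real r *\<^sub>C f) \<in> A" using onto by blast
    \<comment> \<open>As \<open>u\<close> is orthogonal to the domain, changing \<open>A f\<close>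
      by \<open>u\<close> keeps the pair in the adjoint relation; single-valuedness of
      \<open>A\<close> then gives \<open>u = 0\<close>.\<close>
    have "(f, of_real r *\<^sub>C f) \<in> A"
    proof (rule *)
      fix x y assume xy: "(x, y) \<in> A"
      then show "cinner y f = cinner x (of_real r *\<^sub>C f)"
        using sym[OF xy f] u[of x] by (auto simp: cinner_algebra)
    qed
    then show "u = 0" using linear_operator_unique[OF A f] by force
  qed
  moreover have "adjoint_op A = A"
    using * sym unfolding adjoint_op_def by blast
  ultimately show ?thesis
    using A unfolding self_adjoint_op_def densely_defined_def by blast
qed

text \<open>Since \<open>cinner y x\<close> is real, the cross term in the squared norm depends on
  \<open>z\<close> only through its real part. This carries a lower bound from \<open>A - z\<close>
  to \<open>A - cnj z\<close>.\<close>

lemma norm_diff_cnj_scaleC: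
  fixes x y :: "'a::chilbert_space"
  assumes "cinner y x = cinner x y"
  shows "norm (y - cnj z *\<^sub>C x) = norm (y - z *\<^sub>C x)"
proof -
  have "Im (cinner y x) = 0"
    using assms cinner_commute[of x y] by (metis cnj.simps(2) eq_neg_iff_add_eq_0 mult_2 mult_eq_0_iff zero_neq_numeral)
  then have "(norm (y - cnj z *\<^sub>C x))\<^sup>2 = (norm (y - z *\<^sub>C x))\<^sup>2"
    by (simp add: norm_diff_sq norm_scaleC cinner_algebra)
  then show ?thesis by (simp add: power2_eq_iff_nonneg)
qed

text \<open>The range of \<open>A - cnj z\<close> is closed because \<open>A - cnj z\<close> is bounded below by the same constant
  as \<open>A - z\<close>, and it is dense because its orthogonal complement is the kernel of \<open>A - z\<close>.\<close>

lemma self_adjoint_resolvent_onto_cnj: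
  assumes A: "self_adjoint_op A" and z: "z \<in> resolvent_set A"
  shows "\<exists>f. (f, h + cnj z *\<^sub>C f) \<in> A"
proof -
  have lin: "linear_operator A" using A unfolding self_adjoint_op_def by blast
  have memI: "(u, v) \<in> A" if "\<And>x y. (x, y) \<in> A \<Longrightarrow> cinner y u = cinner x v" for u v
    using A that unfolding self_adjoint_op_def adjoint_op_def by blast
  obtain K where K: "\<And>f h. (f, h + z *\<^sub>C f) \<in> A \<Longrightarrow> norm f \<le> K * norm h"
    using resolvent_bound[OF z] by blast
  have bound: "norm f \<le> K * norm k" if f: "(f, k + cnj z *\<^sub>C f) \<in> A" for f k
  proof -
    let ?y = "k + cnj z *\<^sub>C f"
    have "norm (?y - cnj z *\<^sub>C f) = norm (?y - z *\<^sub>C f)"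
      by (rule norm_diff_cnj_scaleC) (rule self_adjoint_op_cinner[OF A f f])
    moreover have "norm f \<le> K * norm (?y - z *\<^sub>C f)" by (rule K) (use f in simp)
    ultimately show ?thesis by simp
  qed
  let ?V = "{k. \<exists>f. (f, k + cnj z *\<^sub>C f) \<in> A}"
  have "closure ?V = UNIV"
  proof (rule dense_if_no_orthogonal)
    show "0 \<in> ?V" using linear_operator_zero[OF lin] by (auto intro: exI[of _ 0])
    show "x + y \<in> ?V" if "x \<in> ?V" "y \<in> ?V" for x y
    proof -
      obtain f g where "(f, x + cnj z *\<^sub>C f) \<in> A" "(g, y + cnj z *\<^sub>C g) \<in> A"
        using \<open>x \<in> ?V\<close> \<open>y \<in> ?V\<close> by blast
      from linear_operator_add[OF lin this] show ?thesis
        by (auto simp: scaleC_add_right add_ac intro!: exI[of _ "f + g"])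
    qed
    show "a *\<^sub>C x \<in> ?V" if "x \<in> ?V" for a x
    proof -
      obtain f where "(f, x + cnj z *\<^sub>C f) \<in> A" using \<open>x \<in> ?V\<close> by blast
      from linear_operator_scaleC[OF lin this, of a] show ?thesis
        by (auto simp: scaleC_add_right scaleC_scaleC mult.commute intro!: exI[of _ "a *\<^sub>C f"])
    qed
    fix u assume u: "\<And>x. x \<in> ?V \<Longrightarrow> cinner x u = 0"
    have "(u, z *\<^sub>C u) \<in> A"
    proof (rule memI)
      fix x y assume "(x, y) \<in> A"
      then have "y - cnj z *\<^sub>C x \<in> ?V" by (auto intro!: exI[of _ x])
      from u[OF this] show "cinner y u = cinner x (z *\<^sub>C u)" by (simp add: cinner_algebra)
    qed
    then show "u = 0"
      using resolvent_unique[OF z, of u 0 0] linear_operator_zero[OF lin] by simp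
  qed
  then have "h \<in> closure ?V" by simp
  then obtain k where k: "\<And>n. k n \<in> ?V" "k \<longlonglongrightarrow> h"
    unfolding closure_sequential by blast
  then obtain f where f: "\<And>n. (f n, k n + cnj z *\<^sub>C f n) \<in> A"
    unfolding mem_Collect_eq by metis
  have gap: "norm (f m - f n) \<le> K * norm (k m - k n)" for m n
    using linear_operator_diff[OF lin f[of m] f[of n]]
    by (intro bound) (simp add: scaleC_diff_right algebra_simps)
  have "Cauchy f"
  proof (rule metric_CauchyI)
    fix e :: real assume e: "e > 0"
    have "Cauchy k" using k(2) LIMSEQ_imp_Cauchy by blast
    then obtain N where N: "\<And>m n. m \<ge> N \<Longrightarrow> n \<ge> N \<Longrightarrow> dist (k m) (k n) < e / (\<bar>K\<bar> + 1)"
      using e metric_CauchyD[of k "e / (\<bar>K\<bar> + 1)"] by auto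
    have "dist (f m) (f n) < e" if "m \<ge> N" "n \<ge> N" for m n
    proof -
      \<comment> \<open>The bound \<open>K\<close> may be zero or negative;
        \<open>\<bar>K\<bar> + 1\<close> is a positive constant by which \<open>e\<close> can be
        divided.\<close>
      have "norm (f m - f n) \<le> (\<bar>K\<bar> + 1) * norm (k m - k n)"
        by (rule order_trans[OF gap]) (intro mult_right_mono, auto)
      also have "\<dots> < e"
        using N[OF that] by (simp add: dist_norm field_simps)
      finally show ?thesis by (simp add: dist_norm)
    qed
    then show "\<exists>N. \<forall>m\<ge>N. \<forall>n\<ge>N. dist (f m) (f n) < e" by blast
  qed
  then obtain l where l: "f \<longlonglongrightarrow> l"
    using Cauchy_convergent convergent_def by blast
  \<comment> \<open>Closedness of \<open>A\<close> comes from \<open>A\<close> being its own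
    adjoint: the limit pair only has to be tested against the graph of \<open>A\<close>, where the
    inner product is continuous.\<close>
  have "(l, h + cnj z *\<^sub>C l) \<in> A"
  proof (rule memI)
    fix x y assume xy: "(x, y) \<in> A"
    have eq: "cinner y (f n) = cinner x (k n) + z * cinner x (f n)" for n
      using self_adjoint_op_cinner[OF A xy f[of n]] by (simp add: cinner_algebra)
    have "(\<lambda>n. cinner x (k n) + z * cinner x (f n)) \<longlonglongrightarrow> cinner x h + z * cinner x l"
      by (intro tendsto_intros tendsto_cinner_right k l)
    moreover have "(\<lambda>n. cinner y (f n)) \<longlonglongrightarrow> cinner y l"
      using l by (rule tendsto_cinner_right)
    ultimately show "cinner y l = cinner x (h + cnj z *\<^sub>C l)"
      unfolding eq by (simp add: LIMSEQ_unique cinner_algebra)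
  qed
  then show ?thesis by blast
qed

section \<open>Quasi boundary triples\<close>

locale qb_triple =
  fixes S T :: "('h::chilbert_space, 'h) graph"
    and \<Gamma>\<^sub>0 \<Gamma>\<^sub>1 :: "('h, 'g::chilbert_space) graph"
  assumes qbt: "quasi_boundary_triple S T \<Gamma>\<^sub>0 \<Gamma>\<^sub>1"
begin

abbreviation "A\<^sub>0 \<equiv> T \<restriction> op_ker \<Gamma>\<^sub>0"
abbreviation "\<gamma> \<equiv> gamma_field T \<Gamma>\<^sub>0"
abbreviation "M \<equiv> weyl_function T \<Gamma>\<^sub>0 \<Gamma>\<^sub>1"

lemma linear: "linear_operator T" "linear_operator \<Gamma>\<^sub>0" "linear_operator \<Gamma>\<^sub>1"
  and domain: "Domain \<Gamma>\<^sub>0 = Domain T" "Domain \<Gamma>\<^sub>1 = Domain T"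
  and self_adjoint_A0: "self_adjoint_op A\<^sub>0"
  using qbt unfolding quasi_boundary_triple_def by blast+

lemma green:
  assumes "(f, f') \<in> T" "(f, a) \<in> \<Gamma>\<^sub>0" "(f, b) \<in> \<Gamma>\<^sub>1"
    and "(g, g') \<in> T" "(g, c) \<in> \<Gamma>\<^sub>0" "(g, d) \<in> \<Gamma>\<^sub>1"
  shows "cinner f' g - cinner f g' = cinner b c - cinner a d"
proof -
  have "cinner (T \<cdot> f) g - cinner f (T \<cdot> g) =
      cinner (\<Gamma>\<^sub>1 \<cdot> f) (\<Gamma>\<^sub>0 \<cdot> g) - cinner (\<Gamma>\<^sub>0 \<cdot> f) (\<Gamma>\<^sub>1 \<cdot> g)"
    using qbt assms(1,4) unfolding quasi_boundary_triple_def by blast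
  then show ?thesis
    using assms by (simp add: op_app_eq linear)
qed

lemma boundary_values:
  assumes "(f, f') \<in> T"
  obtains a b where "(f, a) \<in> \<Gamma>\<^sub>0" "(f, b) \<in> \<Gamma>\<^sub>1"
  using assms domain by blast

text \<open>The joint range of both boundary maps lies in
  \<open>Range \<Gamma>\<^sub>0 \<times> UNIV\<close>, and the closure of a product is the product
  of the closures.\<close>

lemma dense_range: "closure (Range \<Gamma>\<^sub>0) = UNIV"
proof -
  have "{(\<Gamma>\<^sub>0 \<cdot> f, \<Gamma>\<^sub>1 \<cdot> f) | f. f \<in> Domain T} \<subseteq> Range \<Gamma>\<^sub>0 \<times> UNIV"
    using op_app_mem[OF linear(2)] domain by blast
  from closure_mono[OF this] have "UNIV \<subseteq> closure (Range \<Gamma>\<^sub>0 \<times> (UNIV :: 'g set))"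
    using qbt unfolding quasi_boundary_triple_def by metis
  then show ?thesis by (simp add: closure_Times) blast
qed

lemma mem_A0: "(f, f') \<in> A\<^sub>0 \<longleftrightarrow> (f, f') \<in> T \<and> (f, 0) \<in> \<Gamma>\<^sub>0"
  by (auto simp: op_restrict_def op_ker_def)

lemma mem_gamma: "(x, g) \<in> \<gamma> z \<longleftrightarrow> (g, x) \<in> \<Gamma>\<^sub>0 \<and> (g, z *\<^sub>C g) \<in> T"
  by (auto simp: gamma_field_def op_restrict_def op_ker_def mem_op_diff_scalar)

text \<open>These subspace properties of the graph hold for every \<open>z\<close>;
  single-valuedness is \<open>gamma_unique\<close>, for \<open>z\<close> in the resolvent
  set.\<close>

lemma gamma_linear:
  shows "(0, 0) \<in> \<gamma> z"
    and "(x, g) \<in> \<gamma> z \<Longrightarrow> (x', g') \<in> \<gamma> z \<Longrightarrow> (x + x', g + g') \<in> \<gamma> z"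
    and "(x, g) \<in> \<gamma> z \<Longrightarrow> (a *\<^sub>C x, a *\<^sub>C g) \<in> \<gamma> z"
proof -
  show "(0, 0) \<in> \<gamma> z"
    using linear_operator_zero[OF linear(1)] linear_operator_zero[OF linear(2)] by (simp add: mem_gamma)
  show "(x, g) \<in> \<gamma> z \<Longrightarrow> (x', g') \<in> \<gamma> z \<Longrightarrow> (x + x', g + g') \<in> \<gamma> z"
    using linear_operator_add[OF linear(1)] linear_operator_add[OF linear(2)]
    by (simp add: mem_gamma scaleC_add_right)
  show "(x, g) \<in> \<gamma> z \<Longrightarrow> (a *\<^sub>C x, a *\<^sub>C g) \<in> \<gamma> z"
    using linear_operator_scaleC[OF linear(1), of g "z *\<^sub>C g" a]
      linear_operator_scaleC[OF linear(2)]
    by (simp add: mem_gamma scaleC_scaleC mult.commute)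
qed

lemma mem_weyl: "(x, y) \<in> M z \<longleftrightarrow> (\<exists>g. (x, g) \<in> \<gamma> z \<and> (g, y) \<in> \<Gamma>\<^sub>1)"
  by (auto simp: weyl_function_def op_prod_def)

text \<open>Two elements of the kernel of \<open>T - z\<close> with the same
  \<open>\<Gamma>\<^sub>0\<close> value differ by an element of the kernel of
  \<open>A\<^sub>0 - z\<close>, which is trivial.\<close>

lemma gamma_unique:
  assumes z: "z \<in> resolvent_set A\<^sub>0" and "(x, g) \<in> \<gamma> z" "(x, g') \<in> \<gamma> z"
  shows "g = g'"
proof -
  have "(g, z *\<^sub>C g) \<in> T" "(g', z *\<^sub>C g') \<in> T" "(g, x) \<in> \<Gamma>\<^sub>0" "(g', x) \<in> \<Gamma>\<^sub>0"
    using assms(2,3) unfolding mem_gamma by blast+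
  then have "(g - g', z *\<^sub>C (g - g')) \<in> T" "(g - g', x - x) \<in> \<Gamma>\<^sub>0"
    unfolding scaleC_diff_right by (blast intro!: linear_operator_diff linear)+
  then have "(g - g', 0 + z *\<^sub>C (g - g')) \<in> A\<^sub>0" by (simp add: mem_A0)
  moreover have "(0, 0 + z *\<^sub>C 0) \<in> A\<^sub>0"
    using linear_operator_zero[OF linear(1)] linear_operator_zero[OF linear(2)] by (simp add: mem_A0)
  ultimately have "g - g' = 0" by (rule resolvent_unique[OF z])
  then show ?thesis by simp
qed

text \<open>Subtracting from \<open>f\<close> a solution \<open>k\<close> of
  \<open>(A\<^sub>0 - z) k = (T - z) f\<close> leaves an element of the kernel of
  \<open>T - z\<close> and keeps the value of \<open>\<Gamma>\<^sub>0\<close>. Assuming surjectivity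
  alone allows the use at \<open>cnj z\<close>, where \<open>self_adjoint_resolvent_onto_cnj\<close>
  supplies it.\<close>

lemma gamma_total:
  assumes onto: "\<And>h. \<exists>f. (f, h + z *\<^sub>C f) \<in> A\<^sub>0" and x: "x \<in> Range \<Gamma>\<^sub>0"
  obtains g where "(x, g) \<in> \<gamma> z"
proof -
  obtain f f' where f: "(f, x) \<in> \<Gamma>\<^sub>0" "(f, f') \<in> T" using x domain by blast
  obtain k where k: "(k, (f' - z *\<^sub>C f) + z *\<^sub>C k) \<in> T" "(k, 0) \<in> \<Gamma>\<^sub>0"
    using onto mem_A0 by blast
  have "(f - k, x) \<in> \<Gamma>\<^sub>0" "(f - k, z *\<^sub>C (f - k)) \<in> T"
    using linear_operator_diff[OF linear(2) f(1) k(2)] linear_operator_diff[OF linear(1) f(2) k(1)]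
    by (simp_all add: scaleC_diff_right algebra_simps)
  then show thesis using that mem_gamma by blast
qed

text \<open>This identifies the adjoint of \<open>\<gamma> (cnj z)\<close> with
  \<open>\<Gamma>\<^sub>1\<close> applied to the resolvent of \<open>A\<^sub>0\<close> at
  \<open>z\<close>. Green's identity between the kernel of \<open>T - cnj z\<close> and
  \<open>f\<close> gives existence; density of \<open>Range \<Gamma>\<^sub>0\<close> gives
  uniqueness.\<close>

lemma mem_adjoint_gamma:
  assumes z: "z \<in> resolvent_set A\<^sub>0" and f: "(f, h + z *\<^sub>C f) \<in> A\<^sub>0" "(f, b) \<in> \<Gamma>\<^sub>1"
  shows "(h, c) \<in> adjoint_op (\<gamma> (cnj z)) \<longleftrightarrow> c = b"
proof -
  have eq: "cinner g h = cinner x b" if "(x, g) \<in> \<gamma> (cnj z)" for x g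
  proof -
    have g: "(g, x) \<in> \<Gamma>\<^sub>0" "(g, cnj z *\<^sub>C g) \<in> T" using that mem_gamma by blast+
    obtain d where d: "(g, d) \<in> \<Gamma>\<^sub>1" using boundary_values[OF g(2)] by blast
    show ?thesis
      using green[OF g(2,1) d _ _ f(2), of "h + z *\<^sub>C f" 0] f(1)
      by (simp add: mem_A0 cinner_algebra)
  qed
  show ?thesis
  proof
    assume "c = b"
    then show "(h, c) \<in> adjoint_op (\<gamma> (cnj z))" using eq by (auto simp: adjoint_op_def)
  next
    assume c: "(h, c) \<in> adjoint_op (\<gamma> (cnj z))"
    have "c - b = 0"
    proof (rule dense_orthogonal_zero[OF dense_range])
      fix x assume "x \<in> Range \<Gamma>\<^sub>0"
      then obtain g where g: "(x, g) \<in> \<gamma> (cnj z)"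
        using gamma_total self_adjoint_resolvent_onto_cnj[OF self_adjoint_A0 z] by blast
      then have "cinner g h = cinner x c" using c by (auto simp: adjoint_op_def)
      then show "cinner x (c - b) = 0" using eq[OF g] by (simp add: cinner_diff_right)
    qed
    then show "c = b" by simp
  qed
qed

end

section \<open>The extension with boundary condition
  \<open>\<Gamma>\<^sub>0 f = B (\<Gamma>\<^sub>1 f)\<close>\<close>

locale qb_triple_perturbation = qb_triple S T \<Gamma>\<^sub>0 \<Gamma>\<^sub>1
  for S T :: "('h::chilbert_space, 'h) graph"
    and \<Gamma>\<^sub>0 \<Gamma>\<^sub>1 :: "('h, 'g::chilbert_space) graph" +
  fixes B B\<^sub>1 B\<^sub>2 :: "('g, 'g) graph"
  assumes B: "linear_operator B"
    and B12: "linear_operator B\<^sub>1" "linear_operator B\<^sub>2" "B \<subseteq> B\<^sub>1 \<odot> B\<^sub>2"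
    and range_domain: "Range \<Gamma>\<^sub>1 \<subseteq> Domain B"
begin

abbreviation "A_B \<equiv> ext_operator T \<Gamma>\<^sub>0 \<Gamma>\<^sub>1 B"

lemma mem_A_B: "(f, f') \<in> A_B \<longleftrightarrow> (f, f') \<in> T \<and> (\<exists>a b. (f, a) \<in> \<Gamma>\<^sub>0 \<and> (f, b) \<in> \<Gamma>\<^sub>1 \<and> (b, a) \<in> B)"
proof -
  have "(f, f') \<in> A_B \<longleftrightarrow> (f, f') \<in> T \<and> \<Gamma>\<^sub>1 \<cdot> f \<in> Domain B \<and> \<Gamma>\<^sub>0 \<cdot> f = B \<cdot> (\<Gamma>\<^sub>1 \<cdot> f)"
    by (auto simp: ext_operator_def op_restrict_def)
  also have "\<dots> \<longleftrightarrow> (f, f') \<in> T \<and> (\<exists>a b. (f, a) \<in> \<Gamma>\<^sub>0 \<and> (f, b) \<in> \<Gamma>\<^sub>1 \<and> (b, a) \<in> B)"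
    using op_app_eq[OF linear(2)] op_app_eq[OF linear(3)] op_app_eq[OF B] op_app_mem[OF B]
      boundary_values by (metis Domain.DomainI)
  finally show ?thesis .
qed

lemma factorize:
  assumes "y \<in> Range \<Gamma>\<^sub>1"
  obtains w x where "(y, w) \<in> B\<^sub>2" "(w, x) \<in> B\<^sub>1" "(y, x) \<in> B"
  using assms range_domain B12(3) unfolding op_prod_def by blast

text \<open>On the range of \<open>\<Gamma>\<^sub>1\<close> the inclusion of \<open>B\<close> in the
  product becomes an equality, because \<open>B\<close> is defined there and the product is
  single-valued.\<close>

lemma mem_B:
  assumes "y \<in> Range \<Gamma>\<^sub>1" "(y, w) \<in> B\<^sub>2" "(w, x) \<in> B\<^sub>1"
  shows "(y, x) \<in> B"
  using factorize[OF assms(1)] assms(2,3) linear_operator_unique[OF B12(1)]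
    linear_operator_unique[OF B12(2)] by metis

lemma linear_A_B: "linear_operator A_B"
  unfolding linear_operator_def single_valued_def
proof (intro conjI allI impI)
  show "y = y'" if "(x, y) \<in> A_B" "(x, y') \<in> A_B" for x y y'
    using that unfolding mem_A_B by (blast intro: linear_operator_unique[OF linear(1)])
  show "(0, 0) \<in> A_B"
    using linear_operator_zero[OF linear(1)] linear_operator_zero[OF linear(2)]
      linear_operator_zero[OF linear(3)] linear_operator_zero[OF B]
    unfolding mem_A_B by blast
  show "(x + x', y + y') \<in> A_B" if "(x, y) \<in> A_B" "(x', y') \<in> A_B" for x y x' y'
  proof -
    obtain a b where 1: "(x, y) \<in> T" "(x, a) \<in> \<Gamma>\<^sub>0" "(x, b) \<in> \<Gamma>\<^sub>1" "(b, a) \<in> B"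
      using \<open>(x, y) \<in> A_B\<close> unfolding mem_A_B by blast
    obtain c d where 2: "(x', y') \<in> T" "(x', c) \<in> \<Gamma>\<^sub>0" "(x', d) \<in> \<Gamma>\<^sub>1" "(d, c) \<in> B"
      using \<open>(x', y') \<in> A_B\<close> unfolding mem_A_B by blast
    show ?thesis
      using linear_operator_add[OF linear(1) 1(1) 2(1)] linear_operator_add[OF linear(2) 1(2) 2(2)]
        linear_operator_add[OF linear(3) 1(3) 2(3)] linear_operator_add[OF B 1(4) 2(4)]
      unfolding mem_A_B by blast
  qed
  show "(a *\<^sub>C x, a *\<^sub>C y) \<in> A_B" if "(x, y) \<in> A_B" for a x y
  proof -
    obtain c b where 1: "(x, y) \<in> T" "(x, c) \<in> \<Gamma>\<^sub>0" "(x, b) \<in> \<Gamma>\<^sub>1" "(b, c) \<in> B"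
      using \<open>(x, y) \<in> A_B\<close> unfolding mem_A_B by blast
    note scale = linear_operator_scaleC[where a = a]
    show ?thesis
      using scale[OF linear(1) 1(1)] scale[OF linear(2) 1(2)] scale[OF linear(3) 1(3)] scale[OF B 1(4)]
      unfolding mem_A_B by blast
  qed
qed

text \<open>With \<open>a = B b\<close> and \<open>c = B d\<close> the boundary terms in Green's
  identity cancel by the symmetry of \<open>B\<close>.\<close>

lemma A_B_symmetric:
  assumes sym: "symmetric_op B" and "(x, y) \<in> A_B" "(u, v) \<in> A_B"
  shows "cinner y u = cinner x v"
proof -
  obtain a b where x: "(x, y) \<in> T" "(x, a) \<in> \<Gamma>\<^sub>0" "(x, b) \<in> \<Gamma>\<^sub>1" "(b, a) \<in> B"
    using assms unfolding mem_A_B by blast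
  obtain c d where u: "(u, v) \<in> T" "(u, c) \<in> \<Gamma>\<^sub>0" "(u, d) \<in> \<Gamma>\<^sub>1" "(d, c) \<in> B"
    using assms unfolding mem_A_B by blast
  have "cinner (B \<cdot> b) d = cinner b (B \<cdot> d)"
    using sym x(4) u(4) unfolding symmetric_op_def by blast
  then have "cinner a d = cinner b c"
    using op_app_eq[OF B] x(4) u(4) by simp
  then show ?thesis using green[OF x(1-3) u(1-3)] by simp
qed

lemma A_B_onto:
  assumes z: "z \<in> resolvent_set A\<^sub>0"
    and closable: "closable (M z \<odot> B\<^sub>1)"
    and i: "1 \<in> resolvent_set (B\<^sub>2 \<odot> closure (M z \<odot> B\<^sub>1))"
    and ii: "Range (B\<^sub>2 \<odot> closure (M z \<odot> B\<^sub>1)) \<subseteq> Range \<Gamma>\<^sub>0 \<inter> Domain B\<^sub>1"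
    and iii: "B\<^sub>1 `` Range \<Gamma>\<^sub>0 \<subseteq> Range \<Gamma>\<^sub>0"
    and iv: "B\<^sub>2 `` Range \<Gamma>\<^sub>1 \<subseteq> Range \<Gamma>\<^sub>0"
  shows "\<exists>f. (f, h + z *\<^sub>C f) \<in> A_B"
proof -
  obtain f\<^sub>0 where f\<^sub>0: "(f\<^sub>0, h + z *\<^sub>C f\<^sub>0) \<in> T" "(f\<^sub>0, 0) \<in> \<Gamma>\<^sub>0"
    using resolvent_onto[OF z] mem_A0 by metis
  obtain b where b: "(f\<^sub>0, b) \<in> \<Gamma>\<^sub>1" using boundary_values[OF f\<^sub>0(1)] by blast
  then obtain w v where w: "(b, w) \<in> B\<^sub>2" "(w, v) \<in> B\<^sub>1" using factorize by blast
  \<comment> \<open>The resolvent at 1 is applied to \<open>- w\<close>, since it inverts the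
    product minus 1 rather than 1 minus the product.\<close>
  obtain \<psi> where \<psi>: "(\<psi>, \<psi> - w) \<in> B\<^sub>2 \<odot> closure (M z \<odot> B\<^sub>1)"
    using resolvent_onto[OF i, of "- w"] by auto
  then obtain m where m: "(\<psi>, m) \<in> closure (M z \<odot> B\<^sub>1)" "(m, \<psi> - w) \<in> B\<^sub>2"
    unfolding op_prod_def by blast
  \<comment> \<open>Both summands of \<open>\<psi> = (\<psi> - w) + w\<close> lie in the range of
    \<open>\<Gamma>\<^sub>0\<close> and in the domain of \<open>B\<^sub>1\<close>: the first by
    (ii), the second by (iv) and the factorization of \<open>B\<close>.\<close>
  obtain u s where u: "(u, \<psi> - w) \<in> \<Gamma>\<^sub>0" "(\<psi> - w, s) \<in> B\<^sub>1" using \<psi> ii by blast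
  obtain t where t: "(t, w) \<in> \<Gamma>\<^sub>0" using iv b w(1) by blast
  have "(u + t, \<psi>) \<in> \<Gamma>\<^sub>0" using linear_operator_add[OF linear(2) u(1) t] by simp
  moreover have "(\<psi>, s + v) \<in> B\<^sub>1" using linear_operator_add[OF B12(1) u(2) w(2)] by simp
  ultimately obtain \<phi> where \<phi>: "(\<psi>, \<phi>) \<in> B\<^sub>1" "\<phi> \<in> Range \<Gamma>\<^sub>0" using iii by blast
  then obtain g where g: "(\<phi>, g) \<in> \<gamma> z"
    using gamma_total resolvent_onto[OF z] by metis
  then have gT: "(g, \<phi>) \<in> \<Gamma>\<^sub>0" "(g, z *\<^sub>C g) \<in> T" using mem_gamma by blast+
  obtain n where n: "(g, n) \<in> \<Gamma>\<^sub>1" using boundary_values[OF gT(2)] by blast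
  have "(\<psi>, n) \<in> M z \<odot> B\<^sub>1" using \<phi>(1) g n mem_weyl unfolding op_prod_def by blast
  \<comment> \<open>Here the closure disappears: \<open>\<psi>\<close> is in the domain of
    \<open>M z \<odot> B\<^sub>1\<close>, and closability makes its two values equal.\<close>
  then have "m = n"
    using m(1) closable closure_subset unfolding closable_def single_valued_def by blast
  then have "(b + n, w + (\<psi> - w)) \<in> B\<^sub>2" using linear_operator_add[OF B12(2) w(1)] m(2) by blast
  then have "(b + n, \<psi>) \<in> B\<^sub>2" by simp
  moreover have bn: "(f\<^sub>0 + g, b + n) \<in> \<Gamma>\<^sub>1" using linear_operator_add[OF linear(3) b n] .
  ultimately have "(b + n, \<phi>) \<in> B" using \<phi>(1) by (blast intro: mem_B)
  moreover have "(f\<^sub>0 + g, \<phi>) \<in> \<Gamma>\<^sub>0" using linear_operator_add[OF linear(2) f\<^sub>0(2) gT(1)] by simp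
  moreover have "(f\<^sub>0 + g, h + z *\<^sub>C (f\<^sub>0 + g)) \<in> T"
    using linear_operator_add[OF linear(1) f\<^sub>0(1) gT(2)] by (simp add: scaleC_add_right add_ac)
  ultimately show ?thesis using bn unfolding mem_A_B by blast
qed

section \<open>The resolvent formula\<close>

abbreviation "Q z \<equiv> scalar_op 1 \<ominus> B\<^sub>2 \<odot> M z \<odot> B\<^sub>1"

lemma mem_Q:
  "(\<psi>, w) \<in> Q z \<longleftrightarrow> (\<exists>\<phi> g m. (\<psi>, \<phi>) \<in> B\<^sub>1 \<and> (\<phi>, g) \<in> \<gamma> z \<and> (g, m) \<in> \<Gamma>\<^sub>1 \<and> (m, \<psi> - w) \<in> B\<^sub>2)"
proof -
  have "(\<psi>, w) \<in> Q z \<longleftrightarrow> (\<exists>v. w = \<psi> - v \<and> (\<psi>, v) \<in> B\<^sub>2 \<odot> M z \<odot> B\<^sub>1)"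
    unfolding op_diff_def scalar_op_def by auto
  also have "\<dots> \<longleftrightarrow> (\<psi>, \<psi> - w) \<in> B\<^sub>2 \<odot> M z \<odot> B\<^sub>1"
    by (metis add_diff_cancel_left' diff_add_cancel)
  also have "\<dots> \<longleftrightarrow> (\<exists>\<phi> g m. (\<psi>, \<phi>) \<in> B\<^sub>1 \<and> (\<phi>, g) \<in> \<gamma> z \<and> (g, m) \<in> \<Gamma>\<^sub>1 \<and> (m, \<psi> - w) \<in> B\<^sub>2)"
    unfolding op_prod_def relcomp_unfold by (auto simp: mem_weyl)
  finally show ?thesis .
qed

text \<open>These properties of the graph pass unchanged to its converse, for which
  \<open>Q_injective\<close> yields single-valuedness.\<close>

lemma Q_linear:
  shows "(0, 0) \<in> Q z"
    and "(x, y) \<in> Q z \<Longrightarrow> (x', y') \<in> Q z \<Longrightarrow> (x + x', y + y') \<in> Q z"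
    and "(x, y) \<in> Q z \<Longrightarrow> (a *\<^sub>C x, a *\<^sub>C y) \<in> Q z"
proof -
  show "(0, 0) \<in> Q z"
    unfolding mem_Q using linear_operator_zero gamma_linear(1) linear(3) B12(1,2)
    by (metis diff_zero)
  show "(x + x', y + y') \<in> Q z" if xy: "(x, y) \<in> Q z" "(x', y') \<in> Q z"
  proof -
    obtain \<phi> g m where 1: "(x, \<phi>) \<in> B\<^sub>1" "(\<phi>, g) \<in> \<gamma> z" "(g, m) \<in> \<Gamma>\<^sub>1" "(m, x - y) \<in> B\<^sub>2"
      using xy(1) unfolding mem_Q by blast
    obtain \<phi>' g' m' where 2: "(x', \<phi>') \<in> B\<^sub>1" "(\<phi>', g') \<in> \<gamma> z" "(g', m') \<in> \<Gamma>\<^sub>1" "(m', x' - y') \<in> B\<^sub>2"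
      using xy(2) unfolding mem_Q by blast
    have "(m + m', x + x' - (y + y')) \<in> B\<^sub>2"
      using linear_operator_add[OF B12(2) 1(4) 2(4)] by (simp add: algebra_simps)
    then show ?thesis
      using linear_operator_add[OF B12(1) 1(1) 2(1)] gamma_linear(2)[OF 1(2) 2(2)]
        linear_operator_add[OF linear(3) 1(3) 2(3)] unfolding mem_Q by blast
  qed
  show "(a *\<^sub>C x, a *\<^sub>C y) \<in> Q z" if "(x, y) \<in> Q z"
  proof -
    obtain \<phi> g m where 1: "(x, \<phi>) \<in> B\<^sub>1" "(\<phi>, g) \<in> \<gamma> z" "(g, m) \<in> \<Gamma>\<^sub>1" "(m, x - y) \<in> B\<^sub>2"
      using \<open>(x, y) \<in> Q z\<close> unfolding mem_Q by blast
    have "(a *\<^sub>C m, a *\<^sub>C x - a *\<^sub>C y) \<in> B\<^sub>2"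
      using linear_operator_scaleC[OF B12(2) 1(4), of a] by (simp add: scaleC_diff_right)
    then show ?thesis
      using linear_operator_scaleC[OF B12(1) 1(1), of a] gamma_linear(3)[OF 1(2), of a]
        linear_operator_scaleC[OF linear(3) 1(3), of a] unfolding mem_Q by blast
  qed
qed

text \<open>If \<open>\<psi> = B\<^sub>2 M(z) B\<^sub>1 \<psi>\<close>, then \<open>\<gamma>(z) B\<^sub>1 \<psi>\<close> is in the kernel of \<open>A_B - z\<close>.\<close>

lemma Q_injective:
  assumes z: "z \<in> resolvent_set A_B" and \<psi>: "(\<psi>, 0) \<in> Q z"
  shows "\<psi> = 0"
proof -
  obtain \<phi> g m where 1: "(\<psi>, \<phi>) \<in> B\<^sub>1" "(\<phi>, g) \<in> \<gamma> z" "(g, m) \<in> \<Gamma>\<^sub>1" "(m, \<psi>) \<in> B\<^sub>2"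
    using \<psi> by (auto simp: mem_Q)
  have "(m, \<phi>) \<in> B" using mem_B 1 by blast
  then have "(g, 0 + z *\<^sub>C g) \<in> A_B" using 1(2,3) by (auto simp: mem_A_B mem_gamma)
  moreover have "(0, 0 + z *\<^sub>C 0) \<in> A_B" using linear_operator_zero[OF linear_A_B] by simp
  ultimately have "g = 0" by (rule resolvent_unique[OF z])
  then have "m = 0" using 1(3) linear_operator_zero[OF linear(3)] linear_operator_unique[OF linear(3)]
    by blast
  then show ?thesis using 1(4) linear_operator_zero[OF B12(2)] linear_operator_unique[OF B12(2)]
    by blast
qed

text \<open>A trivial kernel makes the inverse single-valued, so the inverse in the resolvent
  formula is a genuine operator.\<close>

lemma linear_Q_inverse:
  assumes z: "z \<in> resolvent_set A_B"
  shows "linear_operator ((Q z)\<inverse>)"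
proof -
  have "x = x'" if "(x, y) \<in> Q z" "(x', y) \<in> Q z" for x x' y
  proof -
    have "(x + (- 1) *\<^sub>C x', y + (- 1) *\<^sub>C y) \<in> Q z"
      by (rule Q_linear(2)[OF that(1) Q_linear(3)[OF that(2)]])
    then have "x - x' = 0" by (intro Q_injective[OF z]) simp
    then show ?thesis by simp
  qed
  then show ?thesis
    using Q_linear unfolding linear_operator_def single_valued_def by blast
qed

text \<open>The graphs agree because the left side is defined everywhere, is contained in the right
  side, and the right side is single-valued.\<close>

lemma krein_formula:
  assumes z\<^sub>0: "z \<in> resolvent_set A\<^sub>0" and z: "z \<in> resolvent_set A_B"
  shows "(A_B \<ominus> scalar_op z)\<inverse> \<ominus> (A\<^sub>0 \<ominus> scalar_op z)\<inverse> =
    \<gamma> z \<odot> B\<^sub>1 \<odot> (Q z)\<inverse> \<odot> B\<^sub>2 \<odot> adjoint_op (\<gamma> (cnj z))" (is "?L = ?R")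
proof -
  have R: "(h, k) \<in> ?R \<longleftrightarrow> (\<exists>b w \<psi> \<phi>. (h, b) \<in> adjoint_op (\<gamma> (cnj z)) \<and> (b, w) \<in> B\<^sub>2 \<and>
      (\<psi>, w) \<in> Q z \<and> (\<psi>, \<phi>) \<in> B\<^sub>1 \<and> (\<phi>, k) \<in> \<gamma> z)" for h k
    unfolding op_prod_def relcomp_unfold by auto
  have L: "(h, k) \<in> ?L \<longleftrightarrow> (\<exists>f f\<^sub>0. k = f - f\<^sub>0 \<and> (f, h + z *\<^sub>C f) \<in> A_B \<and> (f\<^sub>0, h + z *\<^sub>C f\<^sub>0) \<in> A\<^sub>0)"
    for h k
    \<comment> \<open>The instantiation unfolds only the difference of the two inverses, leaving the
      inner differences to \<open>mem_op_diff_scalar\<close>.\<close>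
    unfolding op_diff_def[of "_\<inverse>"] by (auto simp: mem_op_diff_scalar)
  have total: "\<exists>k. (h, k) \<in> ?L" for h
  proof -
    obtain f where "(f, h + z *\<^sub>C f) \<in> A_B" using resolvent_onto[OF z] by blast
    moreover obtain f\<^sub>0 where "(f\<^sub>0, h + z *\<^sub>C f\<^sub>0) \<in> A\<^sub>0" using resolvent_onto[OF z\<^sub>0] by blast
    ultimately show ?thesis unfolding L by blast
  qed
  have sub: "?L \<subseteq> ?R"
  proof (rule subrelI)
    fix h k assume "(h, k) \<in> ?L"
    then obtain f f\<^sub>0 where k: "k = f - f\<^sub>0"
      and f: "(f, h + z *\<^sub>C f) \<in> A_B" and f\<^sub>0: "(f\<^sub>0, h + z *\<^sub>C f\<^sub>0) \<in> A\<^sub>0"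
      unfolding L by blast
    obtain \<phi> y where y: "(f, h + z *\<^sub>C f) \<in> T" "(f, \<phi>) \<in> \<Gamma>\<^sub>0" "(f, y) \<in> \<Gamma>\<^sub>1" "(y, \<phi>) \<in> B"
      using f unfolding mem_A_B by blast
    have f\<^sub>0T: "(f\<^sub>0, h + z *\<^sub>C f\<^sub>0) \<in> T" "(f\<^sub>0, 0) \<in> \<Gamma>\<^sub>0" using f\<^sub>0 mem_A0 by blast+
    then obtain b where b: "(f\<^sub>0, b) \<in> \<Gamma>\<^sub>1" using boundary_values by blast
    \<comment> \<open>Both \<open>f\<close> and \<open>f\<^sub>0\<close> are sent to
      \<open>h\<close> by \<open>T - z\<close>, and \<open>\<Gamma>\<^sub>0\<close> vanishes at
      \<open>f\<^sub>0\<close>.\<close>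
    have "(k, z *\<^sub>C k) \<in> T" "(k, \<phi>) \<in> \<Gamma>\<^sub>0"
      using linear_operator_diff[OF linear(1) y(1) f\<^sub>0T(1)] linear_operator_diff[OF linear(2) y(2) f\<^sub>0T(2)]
      by (simp_all add: k scaleC_diff_right)
    then have \<phi>k: "(\<phi>, k) \<in> \<gamma> z" using mem_gamma by blast
    have kb: "(k, y - b) \<in> \<Gamma>\<^sub>1" using linear_operator_diff[OF linear(3) y(3) b] k by simp
    obtain \<psi> where \<psi>: "(y, \<psi>) \<in> B\<^sub>2" "(\<psi>, \<phi>) \<in> B\<^sub>1"
      using y(4) B12(3) unfolding op_prod_def by blast
    obtain w where w: "(b, w) \<in> B\<^sub>2" using factorize b by blast
    \<comment> \<open>Here \<open>y - b\<close> is the value of \<open>M z\<close> at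
      \<open>\<phi>\<close>, so this line is the equation
      \<open>(1 - B\<^sub>2 M(z) B\<^sub>1) \<psi> = w\<close>.\<close>
    have "(y - b, \<psi> - w) \<in> B\<^sub>2" using linear_operator_diff[OF B12(2) \<psi>(1) w] .
    then have "(\<psi>, w) \<in> Q z" using \<psi>(2) \<phi>k kb unfolding mem_Q by blast
    moreover have "(h, b) \<in> adjoint_op (\<gamma> (cnj z))" using mem_adjoint_gamma[OF z\<^sub>0 f\<^sub>0 b] by blast
    ultimately show "(h, k) \<in> ?R" using w \<psi>(2) \<phi>k unfolding R by blast
  qed
  have unique: "k = k'" if "(h, k) \<in> ?R" "(h, k') \<in> ?R" for h k k'
  proof -
    obtain f\<^sub>0 where f\<^sub>0: "(f\<^sub>0, h + z *\<^sub>C f\<^sub>0) \<in> A\<^sub>0" using resolvent_onto[OF z\<^sub>0] by blast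
    then obtain b where "(f\<^sub>0, b) \<in> \<Gamma>\<^sub>1" using boundary_values mem_A0 by blast
    \<comment> \<open>The equivalence forces both chains through the right side to start with the
      same \<open>b\<close>; each later factor is then single-valued.\<close>
    note adj = mem_adjoint_gamma[OF z\<^sub>0 f\<^sub>0 this]
    obtain w \<psi> \<phi> where 1: "(b, w) \<in> B\<^sub>2" "(\<psi>, w) \<in> Q z" "(\<psi>, \<phi>) \<in> B\<^sub>1" "(\<phi>, k) \<in> \<gamma> z"
      using \<open>(h, k) \<in> ?R\<close> unfolding R adj by blast
    obtain w' \<psi>' \<phi>' where 2: "(b, w') \<in> B\<^sub>2" "(\<psi>', w') \<in> Q z" "(\<psi>', \<phi>') \<in> B\<^sub>1" "(\<phi>', k') \<in> \<gamma> z"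
      using \<open>(h, k') \<in> ?R\<close> unfolding R adj by blast
    have "w = w'" using linear_operator_unique[OF B12(2) 1(1) 2(1)] .
    then have "\<psi> = \<psi>'"
      using linear_operator_unique[OF linear_Q_inverse[OF z], of w \<psi> \<psi>'] 1(2) 2(2) by simp
    then have "\<phi> = \<phi>'" using linear_operator_unique[OF B12(1) 1(3)] 2(3) by simp
    then show ?thesis using gamma_unique[OF z\<^sub>0 1(4)] 2(4) by simp
  qed
  show ?thesis
  proof (intro subset_antisym sub subrelI)
    fix h k assume k: "(h, k) \<in> ?R"
    obtain k' where k': "(h, k') \<in> ?L" using total by blast
    then show "(h, k) \<in> ?L" using unique[OF k subsetD[OF sub k']] by simp
  qed
qed

end

theorem theorem2p2:
  fixes S T A\<^sub>0 :: "('h::chilbert_space, 'h) graph"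
    and \<Gamma>\<^sub>0 \<Gamma>\<^sub>1 :: "('h, 'g::chilbert_space) graph"
    and \<gamma> :: "complex \<Rightarrow> ('g, 'h) graph"
    and M :: "complex \<Rightarrow> ('g, 'g) graph"
    and B B\<^sub>1 B\<^sub>2 :: "('g, 'g) graph"
    and A_B :: "('h, 'h) graph"
    and z\<^sub>0 :: real
  assumes S: "linear_operator S" "densely_defined S" "closed S" "symmetric_op S"
    and qbt: "quasi_boundary_triple S T \<Gamma>\<^sub>0 \<Gamma>\<^sub>1"
    and A\<^sub>0_def: "A\<^sub>0 = T \<restriction> op_ker \<Gamma>\<^sub>0"
    and \<gamma>_def: "\<gamma> = gamma_field T \<Gamma>\<^sub>0"
    and M_def: "M = weyl_function T \<Gamma>\<^sub>0 \<Gamma>\<^sub>1"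
    and z\<^sub>0: "complex_of_real z\<^sub>0 \<in> resolvent_set A\<^sub>0"
    and B: "linear_operator B" "symmetric_op B"
    and B12: "linear_operator B\<^sub>1" "linear_operator B\<^sub>2" "B \<subseteq> B\<^sub>1 \<odot> B\<^sub>2"
    and closable: "closable (M (complex_of_real z\<^sub>0) \<odot> B\<^sub>1)"
    and i: "1 \<in> resolvent_set (B\<^sub>2 \<odot> closure (M (complex_of_real z\<^sub>0) \<odot> B\<^sub>1))"
    and ii: "Range (B\<^sub>2 \<odot> closure (M (complex_of_real z\<^sub>0) \<odot> B\<^sub>1)) \<subseteq> Range \<Gamma>\<^sub>0 \<inter> Domain B\<^sub>1"
    and iii: "B\<^sub>1 `` Range \<Gamma>\<^sub>0 \<subseteq> Range \<Gamma>\<^sub>0"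
    and iv: "B\<^sub>2 `` Range \<Gamma>\<^sub>1 \<subseteq> Range \<Gamma>\<^sub>0"
    and v: "Range \<Gamma>\<^sub>1 \<subseteq> Domain B"
    and A_B_def: "A_B = ext_operator T \<Gamma>\<^sub>0 \<Gamma>\<^sub>1 B"
  shows "self_adjoint_op A_B \<and>
    (\<forall>z \<in> resolvent_set A\<^sub>0 \<inter> resolvent_set A_B.
       linear_operator ((scalar_op 1 \<ominus> B\<^sub>2 \<odot> M z \<odot> B\<^sub>1)\<inverse>) \<and>
       (A_B \<ominus> scalar_op z)\<inverse> \<ominus> (A\<^sub>0 \<ominus> scalar_op z)\<inverse> =
       \<gamma> z \<odot> B\<^sub>1 \<odot> (scalar_op 1 \<ominus> B\<^sub>2 \<odot> M z \<odot> B\<^sub>1)\<inverse> \<odot> B\<^sub>2 \<odot> adjoint_op (\<gamma> (cnj z)))"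
proof -
  interpret P: qb_triple_perturbation S T \<Gamma>\<^sub>0 \<Gamma>\<^sub>1 B B\<^sub>1 B\<^sub>2
    using qbt B(1) B12 v by unfold_locales
  have "self_adjoint_op A_B"
    unfolding A_B_def
    using P.linear_A_B P.A_B_symmetric[OF B(2)]
      P.A_B_onto[OF z\<^sub>0[unfolded A\<^sub>0_def] closable[unfolded M_def] i[unfolded M_def]
        ii[unfolded M_def] iii iv]
    \<comment> \<open>The criterion is applied at the real point
      \<open>r = z\<^sub>0\<close>.\<close>
    by (rule self_adjoint_opI)
  then show ?thesis
    using P.linear_Q_inverse P.krein_formula unfolding A\<^sub>0_def \<gamma>_def M_def A_B_def by blast
qed

end
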